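(* Let ${\bf n}$ be the fixed point starting with $0$ of the morphism $0\mapsto01$, $1\mapsto2$, $2\mapsto0$. For every $m\ge1$, ${\bf n}$ contains an abelian square of order $m$, i.e., a factor $x_1x_2$ with $|x_1|=|x_2|=m$ and $\psi(x_1)=\psi(x_2)$.
   Context: For a word $w$ over $\{0,1,2\}$, its Parikh vector is $\psi(w)=(|w|_0,|w|_1,|w|_2)$, where $|w|_a$ is the number of occurrences of $a$ in $w$. *)

theory Defs
  imports "HOL-Library.Stream"
begin

datatype letter = L0 | L1 | L2

fun mu :: "letter \<Rightarrow> letter list" where
  "mu L0 = [L0, L1]"
| "mu L1 = [L2]"
| "mu L2 = [L0]"

text \<open>
  Infinite words are streams. For a nonerasing morphism given by its values \<open>h\<close> on letters,
  \<open>flat (smap h w)\<close> is the image \<open>h(w\<^sub>0) h(w\<^sub>1) h(w\<^sub>2) \<cdots>\<close> of the infinite word \<open>w\<close>.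
  Only nonerasing \<open>h\<close> give a meaningful result, since \<open>flat\<close> is underspecified on empty blocks.
\<close>

definition morph_inf :: "('a \<Rightarrow> 'b list) \<Rightarrow> 'a stream \<Rightarrow> 'b stream" where
  "morph_inf h w = flat (smap h w)"

text \<open>Existence and uniqueness, which justify the description below, are shown in \<open>n_word_ex1\<close>.\<close>

definition n_word :: "letter stream" where
  "n_word = (THE w. shd w = L0 \<and> morph_inf mu w = w)"

definition factor :: "'a list \<Rightarrow> 'a stream \<Rightarrow> bool" where
  "factor u w \<longleftrightarrow> (\<exists>p s. w = p @- u @- s)"

definition parikh :: "letter list \<Rightarrow> nat \<times> nat \<times> nat" where
  "parikh w = (count_list w L0, count_list w L1, count_list w L2)"


lemma mu_nonempty: "mu a \<noteq> []"
  by (cases a) auto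

lemma morph_inf_SCons: "morph_inf mu (a ## w) = mu a @- morph_inf mu w"
  by (simp add: morph_inf_def flat_Cons mu_nonempty flip: flat_unfold)

text \<open>Writes out the letters of a queue, appending the image of each letter as it is written.\<close>

primcorec queue_word :: "letter list \<Rightarrow> letter stream" where
  "queue_word q = hd q ## queue_word (tl q @ mu (hd q))"

lemma queue_word_fix:
  assumes "q \<noteq> []"
  shows "queue_word q = q @- morph_inf mu (queue_word q)"
  using assms
proof (coinduction arbitrary: q)
  case (Eq_stream q)
  let ?q = "tl q @ mu (hd q)"
  have unf: "queue_word q = hd q ## queue_word ?q"
    by (rule queue_word.code)
  have "stl (q @- morph_inf mu (queue_word q)) = ?q @- morph_inf mu (queue_word ?q)"
    using Eq_stream by (subst unf) (simp add: morph_inf_SCons)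
  moreover have "?q \<noteq> []" by (simp add: mu_nonempty)
  ultimately show ?case
    using Eq_stream by (auto intro!: exI[of _ ?q])
qed

lemma queue_word_unique:
  assumes "q \<noteq> []" "s = q @- morph_inf mu s"
  shows "s = queue_word q"
  using assms
proof (coinduction arbitrary: q s)
  case (Eq_stream q s)
  let ?q = "tl q @ mu (hd q)"
  have hd: "shd s = hd q"
    by (subst Eq_stream(2)) (simp add: Eq_stream(1))
  have s: "s = hd q ## stl s"
    using hd by (metis stream.collapse)
  have "stl s = tl q @- morph_inf mu s"
    by (subst Eq_stream(2)) (simp add: Eq_stream(1))
  also have "\<dots> = ?q @- morph_inf mu (stl s)"
    by (subst s) (simp add: morph_inf_SCons)
  finally have "stl s = ?q @- morph_inf mu (stl s)" .
  moreover have "?q \<noteq> []" by (simp add: mu_nonempty)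
  ultimately show ?case
    using hd by auto
qed

lemma n_word_ex1: "\<exists>!w. shd w = L0 \<and> morph_inf mu w = w"
proof (rule ex1I[of _ "L0 ## queue_word [L1]"])
  show "shd (L0 ## queue_word [L1]) = L0 \<and>
        morph_inf mu (L0 ## queue_word [L1]) = L0 ## queue_word [L1]"
    using queue_word_fix[of "[L1]"] by (simp add: morph_inf_SCons)
next
  fix w assume w: "shd w = L0 \<and> morph_inf mu w = w"
  then have "w = L0 ## stl w" by (metis stream.collapse)
  then have "w = [L0, L1] @- morph_inf mu (stl w)"
    using w by (metis morph_inf_SCons mu.simps(1))
  then have "stl w = [L1] @- morph_inf mu (stl w)"
    by (metis shift.simps stream.sel(2))
  then have "stl w = queue_word [L1]"
    by (intro queue_word_unique) simp_all
  with \<open>w = L0 ## stl w\<close> show "w = L0 ## queue_word [L1]" by simp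
qed

lemma n_word_fixed_point: "shd n_word = L0" "morph_inf mu n_word = n_word"
  using theI'[OF n_word_ex1] by (simp_all add: n_word_def)

end

theory Submission
  imports Defs
begin

text \<open>
  Write \<open>P i\<close> for the Parikh vector of the prefix of length \<open>i\<close>. An abelian square of order \<open>m\<close> is a
  triple of positions \<open>i, j, k\<close> with \<open>P i - 2 P j + P k = 0\<close> and \<open>j - i = m\<close>. Since \<open>n\<close> is a fixed
  point, every position is the start of the image of an earlier position plus a digit \<open>0\<close> or \<open>1\<close>
  (the latter only inside the image of the letter \<open>0\<close>), and \<open>P\<close> transforms linearly under this
  extension. Hence \<open>(i, j, k)\<close> and \<open>m\<close> can be built simultaneously digit by digit, remembering only
  the letters at these positions and the vectors \<open>P i - 2 P j + P k\<close> and \<open>P j - P i - P m\<close>. As the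
  incidence matrix of the morphism is of Pisot type, finitely many vectors matter, so that the
  claim becomes universality of a finite nondeterministic automaton reading the digits of \<open>m\<close> and
  guessing those of \<open>i, j, k\<close>. It is witnessed by a finite family of sets of states that is closed
  under the subset construction up to inclusion, each member containing an accepting state.
\<close>

section \<open>Prefixes of the fixed point and their images\<close>

definition block_start :: "nat \<Rightarrow> nat" where
  "block_start i = length (concat (map mu (stake i n_word)))"

definition prefix_count :: "letter \<Rightarrow> nat \<Rightarrow> int" where
  "prefix_count a i = int (count_list (stake i n_word) a)"

lemma morph_inf_shift: "morph_inf mu (u @- w) = concat (map mu u) @- morph_inf mu w"
  by (induction u) (auto simp: morph_inf_SCons)

text \<open>Applying the morphism to the splitting of \<open>n_word\<close> at its
  \<open>i\<close>-th letter gives back \<open>n_word\<close>, so the image of that letter can be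
  located inside \<open>n_word\<close> itself.\<close>

lemma n_word_unfold_block:
  "n_word = concat (map mu (stake i n_word)) @- mu (n_word !! i) @- morph_inf mu (sdrop (Suc i) n_word)"
proof -
  have "n_word = morph_inf mu (stake i n_word @- (n_word !! i) ## sdrop (Suc i) n_word)"
    by (metis n_word_fixed_point(2) id_stake_snth_sdrop)
  then show ?thesis
    by (simp add: morph_inf_shift morph_inf_SCons)
qed

lemma stake_n_word_block_start:
  assumes "e < length (mu (n_word !! i))"
  shows "stake (block_start i + e) n_word = concat (map mu (stake i n_word)) @ take e (mu (n_word !! i))"
  using assms
  by (subst n_word_unfold_block[of i]) (simp add: stake_shift block_start_def)

lemma n_word_nth_block_start:
  assumes "e < length (mu (n_word !! i))"
  shows "n_word !! (block_start i + e) = mu (n_word !! i) ! e"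
  using assms
  by (subst n_word_unfold_block[of i]) (simp add: shift_snth block_start_def)

lemma count_list_concat_map_mu:
  "count_list (concat (map mu u)) L0 = count_list u L0 + count_list u L2"
  "count_list (concat (map mu u)) L1 = count_list u L0"
  "count_list (concat (map mu u)) L2 = count_list u L1"
proof -
  have "count_list (concat (map mu u)) L0 = count_list u L0 + count_list u L2 \<and>
        count_list (concat (map mu u)) L1 = count_list u L0 \<and>
        count_list (concat (map mu u)) L2 = count_list u L1"
  proof (induction u)
    case (Cons a u)
    then show ?case by (cases a) auto
  qed simp
  then show
    "count_list (concat (map mu u)) L0 = count_list u L0 + count_list u L2"
    "count_list (concat (map mu u)) L1 = count_list u L0"
    "count_list (concat (map mu u)) L2 = count_list u L1" by auto
qed

lemma length_eq_sum_count_list: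
  "length u = count_list u L0 + count_list u L1 + count_list u L2"
proof (induction u)
  case (Cons a u)
  then show ?case by (cases a) auto
qed simp

text \<open>Recovers a position from its Parikh vector, so that statements about lengths follow from
  linear relations between such vectors.\<close>

lemma prefix_count_sum: "prefix_count L0 i + prefix_count L1 i + prefix_count L2 i = int i"
  using length_eq_sum_count_list[of "stake i n_word"] by (simp add: prefix_count_def)

lemma prefix_count_add:
  "prefix_count a (i + l) = prefix_count a i + int (count_list (stake l (sdrop i n_word)) a)"
  by (simp add: prefix_count_def flip: stake_add)

section \<open>Extending positions by a digit\<close>

text \<open>The offsets into the image of a letter, each with the letter found there.\<close>

fun digits :: "letter \<Rightarrow> (int \<times> letter) list" where
  "digits L0 = [(0, L0), (1, L1)]"
| "digits L1 = [(0, L2)]"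
| "digits L2 = [(0, L0)]"

text \<open>This is the incidence matrix of \<open>mu\<close> acting on Parikh vectors, plus the
  digit. The digit only enters the count of \<open>L0\<close>: the sole nonempty proper prefix of an
  image is \<open>[L0]\<close>, inside \<open>mu L0\<close>.\<close>

definition extends :: "nat \<Rightarrow> int \<Rightarrow> nat \<Rightarrow> bool" where
  "extends i e i' \<longleftrightarrow>
    prefix_count L0 i' = prefix_count L0 i + prefix_count L2 i + e \<and>
    prefix_count L1 i' = prefix_count L0 i \<and>
    prefix_count L2 i' = prefix_count L1 i"

lemma extends_block_start:
  assumes "e < length (mu (n_word !! i))"
  shows "extends i (int e) (block_start i + e)"
    and "(int e, n_word !! (block_start i + e)) \<in> set (digits (n_word !! i))"
proof -
  show "extends i (int e) (block_start i + e)"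
    using assms
    unfolding extends_def prefix_count_def stake_n_word_block_start[OF assms]
    by (cases "n_word !! i"; cases e) (auto simp: count_list_concat_map_mu)
  show "(int e, n_word !! (block_start i + e)) \<in> set (digits (n_word !! i))"
    unfolding n_word_nth_block_start[OF assms] using assms
    by (cases "n_word !! i"; cases e) auto
qed

text \<open>Serves the guessed positions: every digit that the current letter permits can really be
  appended.\<close>

lemma digit_extension_exists:
  assumes "(e, a) \<in> set (digits (n_word !! i))"
  shows "\<exists>i'. extends i e i' \<and> n_word !! i' = a"
proof -
  have "nat e < length (mu (n_word !! i))" "e \<ge> 0" "mu (n_word !! i) ! nat e = a"
    using assms by (cases "n_word !! i"; auto)+
  then show ?thesis
    using extends_block_start(1)[of "nat e" i] n_word_nth_block_start[of "nat e" i] by auto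
qed

lemma block_start_Suc: "block_start (Suc i) = block_start i + length (mu (n_word !! i))"
  by (simp add: block_start_def stake_Suc del: stake.simps)

text \<open>All images are nonempty and the image of the first letter \<open>L0\<close> has length
  2, so blocks run ahead of their indices from index 1 on. Block 0 starts at 0, which is why
  position 0 needs separate treatment below.\<close>

lemma block_start_gt: "i \<ge> 1 \<Longrightarrow> i < block_start i"
proof (induction i rule: nat_induct_at_least)
  case base
  show ?case by (simp add: block_start_def n_word_fixed_point)
next
  case (Suc i)
  have "length (mu (n_word !! i)) \<ge> 1" by (cases "n_word !! i") auto
  with Suc show ?case by (simp add: block_start_Suc)
qed

text \<open>Serves the given position \<open>m\<close>: its last digit is stripped off, and the
  remaining position is strictly smaller, which allows induction.\<close>

lemma desubstitution:
  assumes "m \<ge> 1"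
  obtains m0 e where "m0 < m" "extends m0 e m" "(e, n_word !! m) \<in> set (digits (n_word !! m0))"
proof -
  \<comment> \<open>The images of the letters tile \<open>n_word\<close>; \<open>m0\<close> is the
    index of the block that contains position \<open>m\<close>, and the digit is the offset of
    \<open>m\<close> in it.\<close>
  define m0 where "m0 = (LEAST i. m < block_start (Suc i))"
  have ex: "m < block_start (Suc m)"
    using block_start_gt[of "Suc m"] by simp
  have hi: "m < block_start (Suc m0)"
    unfolding m0_def by (rule LeastI[of _ m]) (rule ex)
  have lo: "block_start m0 \<le> m"
  proof (cases m0)
    case 0
    then show ?thesis by (simp add: block_start_def)
  next
    case (Suc l)
    then show ?thesis
      using not_less_Least[of l "\<lambda>i. m < block_start (Suc i)"] by (simp add: m0_def)
  qed
  have "m0 < m"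
    using lo block_start_gt[of m0] assms by (cases "m0 = 0") auto
  moreover have "m - block_start m0 < length (mu (n_word !! m0))"
    using hi lo by (simp add: block_start_Suc)
  ultimately show ?thesis
    using that extends_block_start[of "m - block_start m0" m0] lo by simp
qed

section \<open>The automaton on triples of positions\<close>

type_synonym config = "letter \<times> letter \<times> letter \<times> int \<times> int \<times> int \<times> int \<times> int \<times> int"

definition realised :: "nat \<Rightarrow> config \<Rightarrow> bool" where
  "realised m s \<longleftrightarrow> (\<exists>i j k. s = (n_word !! i, n_word !! j, n_word !! k,
     prefix_count L0 i - 2 * prefix_count L0 j + prefix_count L0 k,
     prefix_count L1 i - 2 * prefix_count L1 j + prefix_count L1 k,
     prefix_count L2 i - 2 * prefix_count L2 j + prefix_count L2 k,
     prefix_count L0 j - prefix_count L0 i - prefix_count L0 m,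
     prefix_count L1 j - prefix_count L1 i - prefix_count L1 m,
     prefix_count L2 j - prefix_count L2 i - prefix_count L2 m))"

fun config_succs :: "int \<Rightarrow> config \<Rightarrow> config list" where
  "config_succs e (a, b, c, x0, x1, x2, y0, y1, y2) =
    [(a', b', c', x0 + x2 + f - 2 * g + h, x0, x1, y0 + y2 + g - f - e, y0, y1).
      (f, a') \<leftarrow> digits a, (g, b') \<leftarrow> digits b, (h, c') \<leftarrow> digits c]"

text \<open>Both vectors in a configuration are integer combinations of prefix Parikh vectors. The
  incidence matrix therefore acts on them directly, and the digits combine with the same
  coefficients.\<close>

lemma realised_succ:
  assumes "realised m s" "extends m e m'" "s' \<in> set (config_succs e s)"
  shows "realised m' s'"
proof -
  obtain i j k where s: "s = (n_word !! i, n_word !! j, n_word !! k,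
     prefix_count L0 i - 2 * prefix_count L0 j + prefix_count L0 k,
     prefix_count L1 i - 2 * prefix_count L1 j + prefix_count L1 k,
     prefix_count L2 i - 2 * prefix_count L2 j + prefix_count L2 k,
     prefix_count L0 j - prefix_count L0 i - prefix_count L0 m,
     prefix_count L1 j - prefix_count L1 i - prefix_count L1 m,
     prefix_count L2 j - prefix_count L2 i - prefix_count L2 m)"
    using assms(1) unfolding realised_def by blast
  obtain f a g b h c where
    dig: "(f, a) \<in> set (digits (n_word !! i))" "(g, b) \<in> set (digits (n_word !! j))"
         "(h, c) \<in> set (digits (n_word !! k))"
    and s': "s' = (a, b, c,
     prefix_count L0 i - 2 * prefix_count L0 j + prefix_count L0 k +
       (prefix_count L2 i - 2 * prefix_count L2 j + prefix_count L2 k) + f - 2 * g + h,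
     prefix_count L0 i - 2 * prefix_count L0 j + prefix_count L0 k,
     prefix_count L1 i - 2 * prefix_count L1 j + prefix_count L1 k,
     prefix_count L0 j - prefix_count L0 i - prefix_count L0 m +
       (prefix_count L2 j - prefix_count L2 i - prefix_count L2 m) + g - f - e,
     prefix_count L0 j - prefix_count L0 i - prefix_count L0 m,
     prefix_count L1 j - prefix_count L1 i - prefix_count L1 m)"
    using assms(3) unfolding s by auto
  \<comment> \<open>The digits in the successor are realised by actual positions, chosen
    independently for the three members of the triple.\<close>
  obtain i' j' k' where
    "extends i f i'" "n_word !! i' = a" "extends j g j'" "n_word !! j' = b"
    "extends k h k'" "n_word !! k' = c"
    using dig digit_extension_exists by meson
  then show ?thesis
    unfolding realised_def s' using assms(2)
    by (intro exI[of _ i'] exI[of _ j'] exI[of _ k']) (simp add: extends_def)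
qed

fun accepting :: "config \<Rightarrow> bool" where
  "accepting (a, b, c, x0, x1, x2, y0, y1, y2) \<longleftrightarrow>
    x0 = 0 \<and> x1 = 0 \<and> x2 = 0 \<and> y0 + y1 + y2 = 0"

text \<open>The vanishing second difference makes the two adjacent factors abelian equivalent. The
  second vector is only needed through its coordinate sum, which is \<open>j - i - m\<close>: the
  prefix of length \<open>m\<close> merely measures length.\<close>

lemma abelian_square_if_realised:
  assumes "realised m s" "accepting s"
  shows "\<exists>x1 x2. factor (x1 @ x2) n_word \<and> length x1 = m \<and> length x2 = m \<and>
           parikh x1 = parikh x2"
proof -
  obtain i j k where eq:
     "prefix_count L0 i - 2 * prefix_count L0 j + prefix_count L0 k = 0"
     "prefix_count L1 i - 2 * prefix_count L1 j + prefix_count L1 k = 0"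
     "prefix_count L2 i - 2 * prefix_count L2 j + prefix_count L2 k = 0"
     "prefix_count L0 j - prefix_count L0 i - prefix_count L0 m +
     (prefix_count L1 j - prefix_count L1 i - prefix_count L1 m) +
     (prefix_count L2 j - prefix_count L2 i - prefix_count L2 m) = 0"
    using assms unfolding realised_def by auto
  \<comment> \<open>Adding the three coordinates turns the relations between Parikh vectors into
    relations between positions.\<close>
  have j: "j = i + m" and k: "k = j + m"
    using eq prefix_count_sum[of i] prefix_count_sum[of j] prefix_count_sum[of k]
      prefix_count_sum[of m] by linarith+
  define x1 where "x1 = stake m (sdrop i n_word)"
  define x2 where "x2 = stake m (sdrop j n_word)"
  have "prefix_count a j = prefix_count a i + int (count_list x1 a)"
    "prefix_count a k = prefix_count a j + int (count_list x2 a)" for a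
    unfolding k x2_def by (simp_all add: j x1_def prefix_count_add)
  then have "parikh x1 = parikh x2"
    using eq by (simp add: parikh_def)
  moreover have "n_word = stake i n_word @- (x1 @ x2) @- sdrop k n_word"
    unfolding x1_def x2_def k j
    by (simp add: stake_sdrop flip: sdrop_add)
       (metis sdrop_add stake_sdrop)
  ultimately show ?thesis
    unfolding factor_def by (intro exI[of _ x1] exI[of _ x2]) (auto simp: x1_def x2_def)
qed

section \<open>A finite certificate of universality\<close>

text \<open>
  Found by computer search: the subset construction, with a subset discarded as soon as it contains
  an earlier one, after greedily deleting states of the automaton as long as every subset reached
  keeps an accepting state. The letter in front of each set is the letter at position \<open>m\<close>. The first
  set belongs to \<open>m = 0\<close>; it is not a singleton because \<open>i, j, k\<close> may have more digits than \<open>m\<close>.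
\<close>

definition certificate :: "(letter \<times> config list) list" where
  "certificate = [
  (L0, [
    (L0, L0, L0, 0, 0, 0, 0, 0, 0), (L0, L0, L1, 1, 0, 0, 0, 0, 0),
    (L0, L1, L1, -1, 0, 0, 1, 0, 0), (L0, L0, L2, 1, 1, 0, 0, 0, 0),
    (L0, L1, L2, -1, 1, 0, 1, 0, 0), (L1, L2, L2, 0, -1, 0, 0, 1, 0),
    (L0, L1, L0, -1, 1, 1, 1, 0, 0), (L0, L2, L0, -1, -1, 1, 1, 1, 0),
    (L1, L2, L0, 0, -1, 1, 0, 1, 0), (L2, L0, L0, 0, 0, -1, 0, 0, 1)]),
  (L1, [
    (L0, L0, L0, 0, -1, -1, 0, 1, 1), (L0, L0, L1, 0, 0, 0, 0, 0, 0),
    (L0, L2, L0, -1, -1, 1, 0, 1, 0), (L0, L2, L0, 0, -1, 1, 0, 1, 0),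
    (L1, L0, L0, 1, -1, -1, -1, 1, 1), (L2, L0, L0, 1, 0, -1, -1, 0, 1),
    (L2, L0, L1, 2, 0, -1, -1, 0, 1)]),
  (L2, [
    (L0, L0, L0, 0, -1, -1, 0, 0, 1), (L0, L0, L0, 1, 0, -1, 0, 0, 1),
    (L0, L0, L1, 1, -1, -1, 0, 0, 1), (L0, L0, L1, 1, 1, 0, 0, -1, 0),
    (L0, L0, L2, 0, 0, 0, 0, 0, 0), (L0, L1, L1, -1, 1, 0, 1, -1, 0),
    (L0, L1, L2, -1, 2, 0, 1, -1, 0), (L1, L0, L0, 0, 0, -1, 0, 0, 1),
    (L1, L0, L0, 2, 0, -1, -1, 0, 1), (L2, L0, L0, 0, 1, -1, 0, -1, 1)]),
  (L0, [
    (L0, L0, L0, 0, 0, 0, 0, 0, 0), (L0, L0, L1, 0, 0, -1, 1, 0, 0),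
    (L0, L0, L1, 0, 0, 1, 1, 0, -1), (L0, L0, L2, 0, 1, -1, 1, 0, 0),
    (L0, L1, L2, -1, 1, 1, 1, 0, -1), (L0, L2, L0, -1, -1, 2, 1, 1, -1),
    (L0, L2, L2, -1, -1, 1, 1, 1, -1), (L1, L0, L2, 1, 1, -1, 0, 0, 0),
    (L1, L1, L0, -1, 1, 0, 1, 0, 0), (L2, L0, L0, -1, 0, 0, 1, 0, 0),
    (L2, L0, L1, 0, 0, 0, 1, 0, 0), (L2, L1, L0, -1, 2, 0, 1, -1, 0)]),
  (L0, [
    (L0, L0, L0, 0, -1, -1, 0, 1, 1), (L0, L0, L0, 0, 0, 0, 0, 0, 0),
    (L0, L0, L0, 1, -1, -1, 0, 1, 1), (L0, L0, L1, 0, -1, 0, 1, 1, 0),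
    (L0, L0, L1, 1, 0, 0, 0, 0, 0), (L0, L0, L2, 1, 0, 0, 0, 1, 0),
    (L0, L1, L1, -1, 0, 0, 1, 0, 0), (L0, L1, L2, -1, 0, 0, 1, 1, 0),
    (L0, L2, L0, -1, -1, 2, 1, 1, -1), (L0, L2, L0, 0, -1, 1, 0, 1, 0),
    (L1, L0, L2, 0, 0, 0, 0, 1, 0), (L2, L1, L0, -2, 1, 1, 1, 0, 0)]),
  (L1, [
    (L0, L0, L0, -1, 0, 1, 0, 1, 0), (L0, L0, L0, 1, -1, -1, -1, 1, 1),
    (L0, L0, L1, 0, -1, 0, 0, 1, 0), (L0, L0, L1, 2, -1, -1, -1, 1, 1),
    (L0, L0, L2, 0, 0, 0, 0, 1, 0), (L0, L2, L1, 0, -1, 2, 0, 1, -1),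
    (L1, L0, L0, 0, 0, 1, -1, 1, 0), (L1, L0, L2, 0, 0, 0, -1, 1, 0),
    (L2, L2, L0, -1, -1, 1, 0, 1, 0), (L2, L2, L1, 0, -1, 1, 0, 1, 0)]),
  (L0, [
    (L0, L0, L0, 0, 0, 0, 0, 0, 0), (L0, L0, L1, 1, 0, 0, 0, 0, 0),
    (L0, L0, L2, 1, 1, 0, 0, 0, 0), (L0, L1, L1, -1, 0, 0, 1, 0, 0),
    (L0, L1, L2, -1, 1, 0, 1, 0, 0), (L1, L1, L0, 0, 1, 0, 0, 0, 1),
    (L1, L2, L2, 0, -1, 0, 0, 1, 0), (L2, L0, L0, 0, 0, 0, 0, 0, 1)]),
  (L1, [
    (L0, L0, L0, 0, 1, -1, 0, 0, 1), (L0, L0, L0, 1, 0, -1, -1, 0, 1),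
    (L0, L0, L1, 0, 0, -1, 0, 0, 1), (L0, L0, L1, 2, -1, -1, -1, 1, 1),
    (L0, L1, L0, -1, 1, 0, 0, 0, 1), (L0, L2, L0, -1, -1, 0, 0, 1, 1),
    (L0, L2, L1, 0, -2, 1, 0, 1, 0), (L1, L0, L2, 1, 0, -1, -1, 1, 1),
    (L2, L0, L0, 0, 0, 0, -1, 0, 1)]),
  (L2, [
    (L0, L0, L0, 0, -1, -1, 0, 0, 1), (L0, L0, L0, 0, 0, 0, 0, 0, 1),
    (L0, L0, L0, 0, 1, -1, 0, -1, 1), (L0, L0, L1, 1, -1, -1, 0, 0, 1),
    (L0, L0, L2, 0, 0, -1, 0, 0, 1), (L0, L0, L2, 1, 0, -1, 0, 0, 1),
    (L0, L0, L2, 2, 0, -1, -1, 0, 1), (L0, L1, L1, -1, 1, -1, 1, -1, 1),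
    (L0, L1, L2, -1, 2, -1, 1, -1, 1), (L1, L0, L0, 1, -1, 0, -1, 0, 1),
    (L2, L1, L1, 0, 0, 0, 0, -1, 1)]),
  (L1, [
    (L0, L0, L0, 0, 0, 0, 0, 0, 0), (L0, L0, L1, 1, 0, 0, 0, 0, 0),
    (L0, L1, L1, -1, 0, 0, 1, 0, 0), (L2, L2, L0, 0, 0, 1, 0, 0, 0)]),
  (L2, [
    (L0, L0, L2, -1, 0, 0, 1, 0, 0), (L0, L0, L2, 1, 0, -2, 0, 0, 1),
    (L0, L1, L1, -1, 1, 0, 1, -1, 0), (L0, L1, L2, -1, 2, -1, 1, -1, 1),
    (L0, L2, L0, -1, -1, 1, 1, 0, 0), (L1, L0, L0, 0, 0, 1, 0, 0, 0),
    (L1, L0, L1, 1, -1, -1, 0, 0, 1), (L1, L0, L2, 0, 0, 0, 0, 0, 0),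
    (L2, L0, L0, 0, 1, 0, 0, -1, 1)]),
  (L0, [
    (L0, L0, L1, 0, 0, -1, 1, 0, 0), (L0, L0, L1, 0, 0, 1, 1, 0, -1),
    (L0, L0, L2, 0, 1, -1, 1, 0, 0), (L0, L1, L0, -1, 2, 0, 1, -1, 0),
    (L1, L0, L0, 0, 0, 0, 0, 0, 0), (L1, L0, L0, 1, 0, 0, 0, 0, 0),
    (L1, L1, L0, -1, 0, 0, 1, 0, 0), (L1, L1, L0, -1, 1, 0, 1, 0, 0),
    (L1, L1, L1, 0, 0, 0, 1, 0, 0), (L1, L2, L0, -1, -1, 2, 1, 1, -1),
    (L1, L2, L2, -1, -1, 1, 1, 1, -1), (L2, L1, L0, -1, 1, -1, 1, -1, 0)]),
  (L2, [
    (L0, L0, L0, 0, 0, 0, 0, 0, 0), (L0, L0, L0, 1, 0, 0, 0, 0, 0),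
    (L0, L0, L2, 1, 1, 0, 0, 0, 0), (L0, L1, L1, -1, 0, 0, 1, 0, 0),
    (L0, L1, L2, -1, 1, 0, 1, 0, 0), (L1, L2, L2, 0, -1, 0, 0, 1, 0)]),
  (L0, [
    (L0, L0, L0, -1, 1, 0, 1, 0, 0), (L0, L0, L0, 0, -1, -1, 1, 1, 0),
    (L0, L0, L0, 0, 0, 1, 1, 0, -1), (L0, L2, L2, -1, -1, 1, 1, 1, -1),
    (L1, L0, L0, 0, -1, 0, 0, 1, 0), (L1, L2, L0, -1, -1, 2, 1, 1, -1),
    (L2, L0, L0, 0, 0, 0, 0, 0, 0), (L2, L0, L0, 1, 0, 0, 0, 0, 0),
    (L2, L0, L2, 0, 1, -1, 1, 0, 0), (L2, L1, L0, -1, 0, 0, 1, 0, 0),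
    (L2, L1, L1, 0, 0, 0, 1, 0, 0)]),
  (L0, [
    (L0, L0, L2, 1, 0, 0, 0, 1, 0), (L0, L2, L0, -1, -1, 2, 1, 1, -1),
    (L0, L2, L1, -1, -1, 1, 1, 1, -1), (L1, L0, L2, 0, 0, 0, 0, 1, 0),
    (L2, L0, L0, 0, -1, -1, 0, 1, 1), (L2, L0, L0, 0, 0, 0, 0, 0, 0),
    (L2, L0, L0, 1, -1, -1, 0, 1, 1), (L2, L0, L1, 1, 0, 0, 0, 0, 0),
    (L2, L1, L0, -1, 1, 0, 1, 0, 0)]),
  (L1, [
    (L0, L0, L0, -1, 0, 1, 0, 1, 0), (L0, L2, L1, 0, -1, 2, 0, 1, -1),
    (L1, L0, L0, 0, 0, 1, -1, 1, 0), (L1, L0, L2, 0, 0, 0, -1, 1, 0),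
    (L2, L0, L0, 1, -1, -1, -1, 1, 1), (L2, L0, L1, 2, -1, -1, -1, 1, 1),
    (L2, L2, L0, -1, -1, 1, 0, 1, 0), (L2, L2, L1, 0, -1, 0, 0, 1, 0),
    (L2, L2, L1, 0, -1, 1, 0, 1, 0), (L2, L2, L2, 0, 0, 0, 0, 1, 0)]),
  (L0, [
    (L0, L0, L0, 0, 0, 0, 0, 0, 0), (L0, L0, L0, 1, 1, 0, 0, 0, 0),
    (L0, L0, L1, 1, 0, 0, 0, 0, 0), (L0, L1, L0, -1, 1, 0, 1, 0, 0),
    (L0, L1, L0, -1, 1, 1, 1, 0, 0), (L0, L1, L1, -1, 0, 0, 1, 0, 0),
    (L0, L2, L0, -1, -1, 1, 1, 1, 0), (L1, L2, L0, 0, -1, 1, 0, 1, 0),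
    (L1, L2, L2, 0, -1, 0, 0, 1, 0), (L2, L0, L0, 0, 0, -1, 0, 0, 1)]),
  (L0, [
    (L0, L0, L0, -1, -1, 1, 1, 1, 0), (L0, L0, L0, 0, -1, -1, 0, 1, 1),
    (L0, L0, L0, 0, 0, 0, 0, 0, 0), (L0, L0, L0, 1, 1, 0, 0, 0, 0),
    (L0, L0, L1, 1, 0, 0, 0, 0, 0), (L0, L1, L0, -1, 1, 0, 1, 0, 0),
    (L0, L1, L1, -1, 0, 0, 1, 0, 0), (L1, L0, L0, 0, -1, 1, 0, 1, 0),
    (L2, L0, L0, 0, 0, -1, 0, 0, 1)]),
  (L1, [
    (L0, L0, L0, -1, -1, 1, 0, 1, 0), (L0, L0, L0, -1, 0, 1, 0, 1, 0),
    (L0, L0, L1, 0, -1, 1, 0, 1, 0), (L0, L2, L1, 0, -1, 0, 0, 1, 0),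
    (L0, L2, L2, 0, 0, 0, 0, 1, 0), (L1, L0, L0, 0, 0, -1, -1, 1, 1),
    (L1, L1, L0, 0, 0, 0, -1, 1, 0), (L2, L0, L0, 1, -1, -1, -1, 1, 1),
    (L2, L0, L1, 2, -1, -1, -1, 1, 1)]),
  (L0, [
    (L0, L0, L0, 0, 0, 0, 0, 0, 0), (L0, L0, L1, 1, 0, 0, 0, 0, 0),
    (L0, L0, L2, 0, -1, -1, 0, 1, 1), (L0, L0, L2, 1, 1, 0, 0, 0, 0),
    (L0, L1, L1, -1, 0, 0, 1, 0, 0), (L0, L1, L2, -1, 1, 0, 1, 0, 0),
    (L1, L1, L0, 0, 1, 0, 0, 0, 1), (L2, L0, L0, 0, 0, 0, 0, 0, 1)]),
  (L1, [
    (L0, L0, L0, 0, 1, -1, 0, 0, 1), (L0, L0, L0, 1, -1, -1, -1, 1, 1),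
    (L0, L0, L1, 0, 0, -1, 0, 0, 1), (L0, L0, L1, 2, -1, -1, -1, 1, 1),
    (L0, L2, L0, -1, -1, 1, 0, 1, 0), (L0, L2, L1, 0, -1, 1, 0, 1, 0),
    (L2, L0, L0, 0, 0, 0, -1, 0, 1)]),
  (L0, [
    (L0, L0, L0, 0, 0, 0, 0, 0, 0), (L0, L0, L1, 1, 0, 0, 0, 0, 0),
    (L0, L0, L2, 1, 1, 0, 0, 0, 0), (L0, L1, L0, -1, 1, 1, 1, 0, 0),
    (L0, L1, L1, -1, 0, 0, 1, 0, 0), (L0, L1, L2, -1, 1, 0, 1, 0, 0),
    (L0, L2, L0, -1, -1, 1, 1, 1, 0), (L1, L0, L0, 0, 0, -1, 0, 0, 1),
    (L1, L2, L0, 0, -1, 1, 0, 1, 0), (L1, L2, L2, 0, -1, 0, 0, 1, 0)]),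
  (L1, [
    (L0, L0, L0, 0, -1, -1, 0, 1, 1), (L0, L0, L1, 0, 0, 0, 0, 0, 0),
    (L0, L2, L0, -1, -1, 1, 0, 1, 0), (L0, L2, L1, 0, -1, 1, 0, 1, 0),
    (L1, L0, L0, 1, -1, -1, -1, 1, 1), (L2, L0, L0, 1, 0, -1, -1, 0, 1),
    (L2, L0, L1, 2, 0, -1, -1, 0, 1)]),
  (L2, [
    (L0, L0, L0, 0, -1, -1, 0, 0, 1), (L0, L0, L0, 0, 0, 0, 0, 0, 1),
    (L0, L0, L0, 0, 1, -1, 0, -1, 1), (L0, L0, L1, 1, -1, -1, 0, 0, 1),
    (L0, L0, L2, 0, 0, -1, 0, 0, 1), (L0, L0, L2, 1, 0, -1, 0, 0, 1),
    (L0, L1, L1, -1, 1, -1, 1, -1, 1), (L0, L1, L2, -1, 2, -1, 1, -1, 1),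
    (L1, L0, L0, 1, -1, 0, -1, 0, 1), (L1, L0, L2, 2, 0, -1, -1, 0, 1),
    (L2, L0, L1, 0, 0, 0, 0, -1, 1)]),
  (L2, [
    (L0, L0, L0, 0, -1, -1, 0, 0, 1), (L0, L0, L0, 0, 1, -1, 0, -1, 1),
    (L0, L0, L1, 1, -1, -1, 0, 0, 1), (L0, L0, L2, 1, 0, -1, 0, 0, 1),
    (L0, L1, L1, -1, 1, -1, 1, -1, 1), (L0, L1, L2, -1, 2, -1, 1, -1, 1),
    (L1, L0, L0, 0, 0, 1, 0, 0, 0), (L1, L0, L2, 0, 0, 0, 0, 0, 0),
    (L1, L0, L2, 2, 0, -1, -1, 0, 1)]),
  (L1, [
    (L0, L0, L0, 0, -1, -1, 0, 1, 1), (L0, L2, L0, -1, -1, 1, 0, 1, 0),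
    (L0, L2, L0, 0, -1, 1, 0, 1, 0), (L1, L0, L0, 1, -1, -1, -1, 1, 1),
    (L2, L0, L0, 1, 0, -1, -1, 0, 1), (L2, L0, L1, 0, 0, 0, 0, 0, 0),
    (L2, L0, L1, 2, 0, -1, -1, 0, 1)]),
  (L2, [
    (L0, L0, L0, 0, -1, -1, 0, 0, 1), (L0, L0, L1, 1, -1, -1, 0, 0, 1),
    (L0, L0, L1, 1, 1, 0, 0, -1, 0), (L0, L0, L2, 0, 0, 0, 0, 0, 0),
    (L0, L0, L2, 1, 0, -1, 0, 0, 1), (L0, L1, L1, -1, 1, 0, 1, -1, 0),
    (L0, L1, L2, -1, 2, 0, 1, -1, 0), (L1, L0, L0, 0, 0, -1, 0, 0, 1),
    (L1, L0, L2, 2, 0, -1, -1, 0, 1), (L2, L0, L0, 0, 1, -1, 0, -1, 1)]),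
  (L0, [
    (L0, L0, L1, 0, 0, -1, 1, 0, 0), (L0, L0, L1, 0, 0, 1, 1, 0, -1),
    (L0, L0, L2, 0, 1, -1, 1, 0, 0), (L1, L0, L0, 0, 0, 0, 0, 0, 0),
    (L1, L0, L0, 1, 0, 0, 0, 0, 0), (L1, L1, L0, -1, 0, 0, 1, 0, 0),
    (L1, L1, L0, -1, 1, 0, 1, 0, 0), (L1, L1, L1, 0, 0, 0, 1, 0, 0),
    (L1, L2, L0, -1, -1, 2, 1, 1, -1), (L1, L2, L2, -1, -1, 1, 1, 1, -1),
    (L2, L1, L0, -1, 1, -1, 1, -1, 0), (L2, L1, L0, -1, 2, 0, 1, -1, 0)]),
  (L0, [
    (L0, L0, L1, 0, 0, -1, 1, 0, 0), (L0, L0, L1, 0, 0, 1, 1, 0, -1),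
    (L0, L0, L2, 0, 1, -1, 1, 0, 0), (L1, L1, L0, -1, 1, 0, 1, 0, 0),
    (L1, L2, L0, -1, -1, 2, 1, 1, -1), (L1, L2, L2, -1, -1, 1, 1, 1, -1),
    (L2, L0, L0, 0, 0, 0, 0, 0, 0), (L2, L0, L0, 1, 0, 0, 0, 0, 0),
    (L2, L1, L0, -1, 0, 0, 1, 0, 0), (L2, L1, L0, -1, 2, 0, 1, -1, 0),
    (L2, L1, L1, 0, 0, 0, 1, 0, 0)]),
  (L0, [
    (L0, L0, L0, 0, 0, 0, 0, 0, 0), (L0, L0, L1, 1, 0, 0, 0, 0, 0),
    (L0, L0, L2, 1, 0, 0, 0, 1, 0), (L0, L1, L0, -1, 1, 0, 1, 0, 0),
    (L0, L1, L1, -1, 0, 0, 1, 0, 0), (L0, L2, L0, -1, -1, 2, 1, 1, -1),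
    (L1, L0, L2, 0, 0, 0, 0, 1, 0), (L2, L0, L0, 0, -1, -1, 0, 1, 1),
    (L2, L0, L0, 1, -1, -1, 0, 1, 1)]),
  (L1, [
    (L0, L0, L0, -1, 0, 1, 0, 1, 0), (L0, L2, L1, 0, -1, 0, 0, 1, 0),
    (L0, L2, L1, 0, -1, 2, 0, 1, -1), (L0, L2, L2, 0, 0, 0, 0, 1, 0),
    (L1, L0, L0, 0, 0, 1, -1, 1, 0), (L1, L0, L2, 0, 0, 0, -1, 1, 0),
    (L2, L0, L0, 1, -1, -1, -1, 1, 1), (L2, L0, L1, 2, -1, -1, -1, 1, 1),
    (L2, L2, L0, -1, -1, 1, 0, 1, 0), (L2, L2, L1, 0, -1, 1, 0, 1, 0)])]"

fun succ_chain :: "config list \<Rightarrow> config list \<Rightarrow> bool" where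
  "succ_chain seen [] \<longleftrightarrow> True"
| "succ_chain seen (s # ss) \<longleftrightarrow>
    list_ex (\<lambda>t. List.member (config_succs 0 t) s) seen \<and> succ_chain (s # seen) ss"

definition covers :: "config list \<Rightarrow> letter \<Rightarrow> letter \<times> config list \<Rightarrow> bool" where
  "covers R q C \<longleftrightarrow> fst C = q \<and> list_all (List.member R) (snd C)"

text \<open>The digit of \<open>m\<close> is prescribed, so each one must be answered by some member
  of the family. Inclusion in the successor set is enough, since dropping configurations only
  forgets possible witnesses.\<close>

definition closed_under_digits :: "(letter \<times> config list) list \<Rightarrow> letter \<times> config list \<Rightarrow> bool" where
  "closed_under_digits Cs C \<longleftrightarrow>
    list_all (\<lambda>(e, q). list_ex (covers (concat (map (config_succs e) (snd C))) q) Cs) (digits (fst C))"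

lemma certificate_closed: "list_all (closed_under_digits certificate) certificate"
  by code_simp

lemma certificate_accepting: "list_all (\<lambda>C. list_ex accepting (snd C)) certificate"
  by code_simp

lemma certificate_initial:
  "\<exists>ss Cs. certificate = (L0, (L0, L0, L0, 0, 0, 0, 0, 0, 0) # ss) # Cs \<and>
     succ_chain [(L0, L0, L0, 0, 0, 0, 0, 0, 0)] ss"
  by (simp add: certificate_def)

section \<open>Running the automaton along the digits of \<open>m\<close>\<close>

text \<open>Leading zeros of \<open>m\<close>: the triple may acquire digits while \<open>m\<close>
  stays 0. The order of the list matters, as each configuration is reached from one already
  seen.\<close>

lemma realised_succ_chain:
  assumes "succ_chain seen ss" "\<forall>s\<in>set seen. realised 0 s"
  shows "\<forall>s\<in>set ss. realised 0 s"
  using assms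
proof (induction ss arbitrary: seen)
  case (Cons s ss)
  obtain t where "realised 0 t" "s \<in> set (config_succs 0 t)"
    using Cons.prems by (auto simp: list_ex_iff)
  \<comment> \<open>Position 0 is its own extension by the digit 0, because its Parikh vector is
    zero.\<close>
  moreover have "extends 0 0 0"
    by (simp add: extends_def prefix_count_def)
  ultimately have "realised 0 s"
    using realised_succ by blast
  with Cons.IH[of "s # seen"] Cons.prems show ?case by simp
qed simp

text \<open>Strong induction follows the digits of \<open>m\<close>: the smaller position from
  \<open>desubstitution\<close> supplies a member of the family, and closure under the last digit
  supplies the next one.\<close>

lemma certificate_realised:
  "\<exists>C\<in>set certificate. fst C = n_word !! m \<and> (\<forall>s\<in>set (snd C). realised m s)"
proof (induction m rule: less_induct)
  case (less m)
  show ?case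
  proof (cases "m = 0")
    case True
    obtain ss Cs where
      eq: "certificate = (L0, (L0, L0, L0, 0, 0, 0, 0, 0, 0) # ss) # Cs" and
      chain: "succ_chain [(L0, L0, L0, 0, 0, 0, 0, 0, 0)] ss"
      using certificate_initial by blast
    \<comment> \<open>All three positions are taken to be 0.\<close>
    have "realised 0 (L0, L0, L0, 0, 0, 0, 0, 0, 0)"
      unfolding realised_def
      by (intro exI[of _ 0]) (simp add: n_word_fixed_point prefix_count_def)
    with realised_succ_chain[OF chain] show ?thesis
      unfolding eq True by (simp add: n_word_fixed_point)
  next
    case False
    then obtain m0 e where m0: "m0 < m" "extends m0 e m"
      "(e, n_word !! m) \<in> set (digits (n_word !! m0))"
      using desubstitution[of m] by auto
    obtain C where C: "C \<in> set certificate" "fst C = n_word !! m0"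
      "\<forall>s\<in>set (snd C). realised m0 s"
      using less.IH[OF m0(1)] by blast
    have "closed_under_digits certificate C"
      using certificate_closed C(1) by (simp add: list_all_iff)
    \<comment> \<open>The letter stored with \<open>C\<close> is the one at \<open>m0\<close>, so
      the last digit of \<open>m\<close> is among those for which closure was checked.\<close>
    then obtain D where "D \<in> set certificate" "fst D = n_word !! m"
      and D: "\<forall>t\<in>set (snd D). \<exists>s\<in>set (snd C). t \<in> set (config_succs e s)"
      using m0(3) C(2)
      by (fastforce simp: closed_under_digits_def covers_def list_all_iff list_ex_iff)
    moreover have "\<forall>t\<in>set (snd D). realised m t"
      using D C(3) realised_succ[OF _ m0(2)] by blast
    ultimately show ?thesis by blast
  qed
qed

theorem theorem28:
  fixes m :: nat
  assumes "m \<ge> 1"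
  shows "\<exists>x1 x2. factor (x1 @ x2) n_word \<and> length x1 = m \<and> length x2 = m \<and>
           parikh x1 = parikh x2"
proof -
  obtain C where "C \<in> set certificate" "\<forall>s\<in>set (snd C). realised m s"
    using certificate_realised by blast
  moreover from this(1) obtain s where "s \<in> set (snd C)" "accepting s"
    using certificate_accepting by (auto simp: list_all_iff list_ex_iff)
  ultimately show ?thesis
    using abelian_square_if_realised by blast
qed

end
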